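(* For all formulas $q_1,\dots,q_n,q\in F(V)$: if $q_1,\dots,q_n\vdash_{\mathrm{sq}\L^*}q$, then $q_1,\dots,q_n\vDash_{\mathbb{SQW^*}}q$.
   Context: Let $V$ be a set of propositional variables and $F(V)$ the set of formulas built from $V$ and the constant $1$ using $\to$ and $\neg$. Abbreviations: $p^+:=(p\to 1)\to 1$, $p^-:=(p\to\neg 1)\to\neg 1$ (binding more tightly than $\neg$), $p\vee q:=((p^+\to q^+)^+\to(\neg p)^-)\to((q^-\to p^-)^-\to p^-)$; an axiom "$p\leftrightarrow q$" stands for the two axioms $p\to q$ and $q\to p$. The logic $\mathrm{sq}\L^*$ has axiom schemas (for all $p,q,r\in F(V)$): (Q1) $(p\to q)\leftrightarrow(\neg q\to\neg p)$; (Q2) $1\leftrightarrow((1\to p)\to 1)$; (Q3) $p\leftrightarrow((q\to q)\to p)$; (Q4) $(p\to q)\leftrightarrow((q^+\to p^-)\to(p^+\to q^-))$; (Q5) $\neg(p\to q)\leftrightarrow(q\to p)$; (Q6) $(p\to(\neg p\to q))^+\leftrightarrow(p^+\to(\neg p^+\to q^+))$; (Q7) $(p\to(q\vee r))\leftrightarrow((p\to r)\vee(p\to q))$; (Q8) $(p\vee(q\vee r))\leftrightarrow((p\vee q)\vee r)$; (Q9) $((p\to 1)\to((q\to 1)\to r))\to((q\to 1)\to((p\to 1)\to r))$; (Q10) $p\to 1$; and rules: (qMP) from $(r\to r)\to p$ and $(r\to r)\to(p\to q)$ infer $(r\to r)\to q$; (Reg) from $p$ infer $(r\to r)\to p$;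 (AReg1) from $(r\to r)\to(p\to q)$ infer $p\to q$; (AReg2) from $(r\to r)\to\neg(p\to q)$ infer $\neg(p\to q)$; (AReg3) from $(r\to r)\to\neg 1$ infer $\neg 1$; (AReg4) from $(r\to r)\to 1$ infer $1$; (Inv1) from $p$ infer $\neg\neg p$; (Inv2) from $\neg\neg p$ infer $p$; (Flat) from $p$ and $\neg 1$ infer $\neg p$; (R2$'$) from $p\to q$ and $r\to t$ infer $(q\to r)\to(p\to t)$; (R3$'$) from $(r\to r)\to p$ infer $p^-$. $q_1,\dots,q_n\vdash_{\mathrm{sq}\L^*}q$ means there is a finite sequence ending with $q$ whose members are axiom instances, among $q_1,\dots,q_n$, or follow from earlier members by rules. Semantics: a quasi-Wajsberg* algebra is an algebra $\langle W;\to,\neg,{}^+,{}^-,1\rangle$ of type $\langle 2,1,1,1,0\rangle$ such that for all $x,y,z$: $x\to y=\neg y\to\neg x$; $(x\to 1)\to((y\to 1)\to z)=(y\to 1)\to((x\to 1)\to z)$; $(1\to x)\to 1=1$; $(z\to z)\to(x\to y)=x\to y$; $(1\to 1)\to x^{+}=((1\to 1)\to x)^{+}=(x\to 1)\to 1$ and $(1\to 1)\to x^{-}=((1\to 1)\to x)^{-}=(x\to\neg 1)\to\neg 1$; $x\to y=(y^{+}\to x^{-})\to(x^{+}\to y^{-})$; $\neg(x\to y)=y\to x$; $\neg\neg x=x$; $(x\to(\neg x\to y))^{+}=x^{+}\to(\neg x^{+}\to y^{+})$; $x\vee y=y\vee x$; $x\vee(y\vee z)=(x\vee y)\vee z$;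 $x\to(y\vee z)=(x\to y)\vee(x\to z)$, with $x\vee y:=((x^{+}\to y^{+})^{+}\to(\neg x)^{-})\to((y^{-}\to x^{-})^{-}\to x^{-})$. A strong quasi-Wajsberg* algebra additionally satisfies $x^+=(1\to 1)\to x^+$ and $x^-=(1\to 1)\to x^-$; $\mathbb{SQW^*}$ is the class of these. An element $d$ of such an algebra $\mathbf{A}$ is designated if $d=(c\to 1)\to 1$ for some $c\in A$. $q_1,\dots,q_n\vDash_{\mathbb{SQW^*}}q$ means: for every $\mathbf{A}\in\mathbb{SQW^*}$ and every assignment of the variables in $A$, if the values of $q_1,\dots,q_n$ are all designated then the value of $q$ is designated. *)

theory Defs
  imports Main
begin

datatype 'v fm = Var 'v | One | Imp "'v fm" "'v fm" | Neg "'v fm"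

definition fplus :: "'v fm \<Rightarrow> 'v fm" where
  "fplus p = Imp (Imp p One) One"

definition fminus :: "'v fm \<Rightarrow> 'v fm" where
  "fminus p = Imp (Imp p (Neg One)) (Neg One)"

definition fjoin :: "'v fm \<Rightarrow> 'v fm \<Rightarrow> 'v fm" where
  "fjoin p q = Imp (Imp (fplus (Imp (fplus p) (fplus q))) (fminus (Neg p)))
                   (Imp (fminus (Imp (fminus q) (fminus p))) (fminus p))"

inductive axiom :: "'v fm \<Rightarrow> bool" where
  Q1a: "axiom (Imp (Imp p q) (Imp (Neg q) (Neg p)))"
| Q1b: "axiom (Imp (Imp (Neg q) (Neg p)) (Imp p q))"
| Q2a: "axiom (Imp One (Imp (Imp One p) One))"
| Q2b: "axiom (Imp (Imp (Imp One p) One) One)"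
| Q3a: "axiom (Imp p (Imp (Imp q q) p))"
| Q3b: "axiom (Imp (Imp (Imp q q) p) p)"
| Q4a: "axiom (Imp (Imp p q) (Imp (Imp (fplus q) (fminus p)) (Imp (fplus p) (fminus q))))"
| Q4b: "axiom (Imp (Imp (Imp (fplus q) (fminus p)) (Imp (fplus p) (fminus q))) (Imp p q))"
| Q5a: "axiom (Imp (Neg (Imp p q)) (Imp q p))"
| Q5b: "axiom (Imp (Imp q p) (Neg (Imp p q)))"
| Q6a: "axiom (Imp (fplus (Imp p (Imp (Neg p) q))) (Imp (fplus p) (Imp (Neg (fplus p)) (fplus q))))"
| Q6b: "axiom (Imp (Imp (fplus p) (Imp (Neg (fplus p)) (fplus q))) (fplus (Imp p (Imp (Neg p) q))))"
| Q7a: "axiom (Imp (Imp p (fjoin q r)) (fjoin (Imp p r) (Imp p q)))"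
| Q7b: "axiom (Imp (fjoin (Imp p r) (Imp p q)) (Imp p (fjoin q r)))"
| Q8a: "axiom (Imp (fjoin p (fjoin q r)) (fjoin (fjoin p q) r))"
| Q8b: "axiom (Imp (fjoin (fjoin p q) r) (fjoin p (fjoin q r)))"
| Q9: "axiom (Imp (Imp (Imp p One) (Imp (Imp q One) r)) (Imp (Imp q One) (Imp (Imp p One) r)))"
| Q10: "axiom (Imp p One)"

inductive deriv :: "'v fm list \<Rightarrow> 'v fm \<Rightarrow> bool" for H :: "'v fm list" where
  ax: "axiom p \<Longrightarrow> deriv H p"
| hyp: "p \<in> set H \<Longrightarrow> deriv H p"
| qMP: "deriv H (Imp (Imp r r) p) \<Longrightarrow> deriv H (Imp (Imp r r) (Imp p q)) \<Longrightarrow> deriv H (Imp (Imp r r) q)"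
| Reg: "deriv H p \<Longrightarrow> deriv H (Imp (Imp r r) p)"
| AReg1: "deriv H (Imp (Imp r r) (Imp p q)) \<Longrightarrow> deriv H (Imp p q)"
| AReg2: "deriv H (Imp (Imp r r) (Neg (Imp p q))) \<Longrightarrow> deriv H (Neg (Imp p q))"
| AReg3: "deriv H (Imp (Imp r r) (Neg One)) \<Longrightarrow> deriv H (Neg One)"
| AReg4: "deriv H (Imp (Imp r r) One) \<Longrightarrow> deriv H One"
| Inv1: "deriv H p \<Longrightarrow> deriv H (Neg (Neg p))"
| Inv2: "deriv H (Neg (Neg p)) \<Longrightarrow> deriv H p"
| Flat: "deriv H p \<Longrightarrow> deriv H (Neg One) \<Longrightarrow> deriv H (Neg p)"
| R2': "deriv H (Imp p q) \<Longrightarrow> deriv H (Imp r t) \<Longrightarrow> deriv H (Imp (Imp q r) (Imp p t))"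
| R3': "deriv H (Imp (Imp r r) p) \<Longrightarrow> deriv H (fminus p)"

definition ajoin :: "('a \<Rightarrow> 'a \<Rightarrow> 'a) \<Rightarrow> ('a \<Rightarrow> 'a) \<Rightarrow> ('a \<Rightarrow> 'a) \<Rightarrow> ('a \<Rightarrow> 'a) \<Rightarrow> 'a \<Rightarrow> 'a \<Rightarrow> 'a" where
  "ajoin imp neg pl mi x y =
     imp (imp (pl (imp (pl x) (pl y))) (mi (neg x))) (imp (mi (imp (mi y) (mi x))) (mi x))"

definition qW_star :: "('a \<Rightarrow> 'a \<Rightarrow> 'a) \<Rightarrow> ('a \<Rightarrow> 'a) \<Rightarrow> ('a \<Rightarrow> 'a) \<Rightarrow> ('a \<Rightarrow> 'a) \<Rightarrow> 'a \<Rightarrow> bool" where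
  "qW_star imp neg pl mi one \<longleftrightarrow>
    (\<forall>x y z.
      imp x y = imp (neg y) (neg x) \<and>
      imp (imp x one) (imp (imp y one) z) = imp (imp y one) (imp (imp x one) z) \<and>
      imp (imp one x) one = one \<and>
      imp (imp z z) (imp x y) = imp x y \<and>
      imp (imp one one) (pl x) = pl (imp (imp one one) x) \<and>
      pl (imp (imp one one) x) = imp (imp x one) one \<and>
      imp (imp one one) (mi x) = mi (imp (imp one one) x) \<and>
      mi (imp (imp one one) x) = imp (imp x (neg one)) (neg one) \<and>
      imp x y = imp (imp (pl y) (mi x)) (imp (pl x) (mi y)) \<and>
      neg (imp x y) = imp y x \<and>
      neg (neg x) = x \<and>
      pl (imp x (imp (neg x) y)) = imp (pl x) (imp (neg (pl x)) (pl y)) \<and>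
      ajoin imp neg pl mi x y = ajoin imp neg pl mi y x \<and>
      ajoin imp neg pl mi x (ajoin imp neg pl mi y z) = ajoin imp neg pl mi (ajoin imp neg pl mi x y) z \<and>
      imp x (ajoin imp neg pl mi y z) = ajoin imp neg pl mi (imp x y) (imp x z))"

definition sqW_star :: "('a \<Rightarrow> 'a \<Rightarrow> 'a) \<Rightarrow> ('a \<Rightarrow> 'a) \<Rightarrow> ('a \<Rightarrow> 'a) \<Rightarrow> ('a \<Rightarrow> 'a) \<Rightarrow> 'a \<Rightarrow> bool" where
  "sqW_star imp neg pl mi one \<longleftrightarrow> qW_star imp neg pl mi one \<and>
    (\<forall>x. pl x = imp (imp one one) (pl x) \<and> mi x = imp (imp one one) (mi x))"

definition designated :: "('a \<Rightarrow> 'a \<Rightarrow> 'a) \<Rightarrow> 'a \<Rightarrow> 'a \<Rightarrow> bool" where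
  "designated imp one d \<longleftrightarrow> (\<exists>c. d = imp (imp c one) one)"

primrec eval :: "('a \<Rightarrow> 'a \<Rightarrow> 'a) \<Rightarrow> ('a \<Rightarrow> 'a) \<Rightarrow> 'a \<Rightarrow> ('v \<Rightarrow> 'a) \<Rightarrow> 'v fm \<Rightarrow> 'a" where
  "eval imp neg one e (Var x) = e x"
| "eval imp neg one e One = one"
| "eval imp neg one e (Imp p q) = imp (eval imp neg one e p) (eval imp neg one e q)"
| "eval imp neg one e (Neg p) = neg (eval imp neg one e p)"

text \<open>Semantic consequence w.r.t. all strong quasi-Wajsberg* algebras on the type 'a;
  the theorem quantifies over all types 'a (type variables are schematic).\<close>

definition sem_conseq :: "'a itself \<Rightarrow> 'v fm list \<Rightarrow> 'v fm \<Rightarrow> bool" where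
  "sem_conseq _ H q \<longleftrightarrow>
    (\<forall>(imp::'a \<Rightarrow> 'a \<Rightarrow> 'a) neg pl mi one (e::'v \<Rightarrow> 'a).
       sqW_star imp neg pl mi one \<longrightarrow>
       (\<forall>p\<in>set H. designated imp one (eval imp neg one e p)) \<longrightarrow>
       designated imp one (eval imp neg one e q))"

end

theory Submission
  imports Defs
begin

text \<open>
  Write \<open>x \<oplus> y\<close> for \<open>\<ominus>x \<rightarrow> y\<close> and 0 for \<open>1 \<rightarrow> 1\<close>; in the standard model this is addition truncated to
  the interval from -1 to 1, and designated means nonnegative.  The whole theorem rests on the equivalence of
  "\<open>x \<rightarrow> y\<close> is designated" with \<open>x \<squnion> y = 0 \<oplus> y\<close>: it turns every axiom into an inequality, and the
  rules qMP and R2' into transitivity and monotonicity.  Addition distributes over joins, and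
  \<open>x \<squnion> 0 = x\<^sup>+\<close>.  Hence if \<open>y - x\<close> is nonnegative, then \<open>(x \<squnion> y) - y = (x - y)\<^sup>+ = 0\<close>, and the
  point is that elements with difference 0 agree up to a summand 0.  By the axiom for
  \<open>(x \<rightarrow> (\<ominus>x \<rightarrow> y))\<^sup>+\<close> this comes down to \<open>(v \<oplus> w) - v \<le> w\<close> for nonnegative \<open>v\<close>, \<open>w\<close>, where
  addition is associative.
\<close>

locale strong_quasi_wajsberg_star =
  fixes imp :: "'a \<Rightarrow> 'a \<Rightarrow> 'a" (infixr "\<rightarrow>" 60)
    and neg :: "'a \<Rightarrow> 'a" ("\<ominus> _" [81] 80)
    and pl mi :: "'a \<Rightarrow> 'a"
    and one :: 'a ("\<one>")
  assumes sqW_star: "sqW_star imp neg pl mi one"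
begin

definition add :: "'a \<Rightarrow> 'a \<Rightarrow> 'a" (infixl "\<oplus>" 65) where
  "x \<oplus> y = (\<ominus>x \<rightarrow> y)"

definition zero :: 'a ("\<zero>") where
  "\<zero> = (\<one> \<rightarrow> \<one>)"

abbreviation join :: "'a \<Rightarrow> 'a \<Rightarrow> 'a" (infixl "\<squnion>" 65) where
  "x \<squnion> y \<equiv> ajoin imp neg pl mi x y"

abbreviation nonneg :: "'a \<Rightarrow> bool" where
  "nonneg \<equiv> designated imp \<one>"

text \<open>
  A quasi-algebra has elements with \<open>\<zero> \<oplus> x \<noteq> x\<close>.  The summand \<open>\<zero>\<close> on the right makes the relation a
  preorder that ignores the difference between \<open>x\<close> and \<open>\<zero> \<oplus> x\<close>.
\<close>

definition leq :: "'a \<Rightarrow> 'a \<Rightarrow> bool" (infix "\<sqsubseteq>" 50) where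
  "x \<sqsubseteq> y \<longleftrightarrow> x \<squnion> y = \<zero> \<oplus> y"


subsection \<open>Implication and truncated addition\<close>

lemma imp_contrapos: "(x \<rightarrow> y) = (\<ominus>y \<rightarrow> \<ominus>x)"
  and imp_exchange: "((x \<rightarrow> \<one>) \<rightarrow> (y \<rightarrow> \<one>) \<rightarrow> z) = ((y \<rightarrow> \<one>) \<rightarrow> (x \<rightarrow> \<one>) \<rightarrow> z)"
  and one_imp_imp_one: "((\<one> \<rightarrow> x) \<rightarrow> \<one>) = \<one>"
  and self_imp_imp: "((z \<rightarrow> z) \<rightarrow> (x \<rightarrow> y)) = (x \<rightarrow> y)"
  and pl_one_imp_one_imp: "pl ((\<one> \<rightarrow> \<one>) \<rightarrow> x) = ((x \<rightarrow> \<one>) \<rightarrow> \<one>)"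
  and mi_one_imp_one_imp: "mi ((\<one> \<rightarrow> \<one>) \<rightarrow> x) = ((x \<rightarrow> \<ominus>\<one>) \<rightarrow> \<ominus>\<one>)"
  and imp_decomp: "(x \<rightarrow> y) = ((pl y \<rightarrow> mi x) \<rightarrow> (pl x \<rightarrow> mi y))"
  and neg_imp: "\<ominus>(x \<rightarrow> y) = (y \<rightarrow> x)"
  and neg_neg [simp]: "\<ominus>(\<ominus>x) = x"
  and pl_imp: "pl (x \<rightarrow> \<ominus>x \<rightarrow> y) = (pl x \<rightarrow> \<ominus>pl x \<rightarrow> pl y)"
  and join_commute: "x \<squnion> y = y \<squnion> x"
  and join_assoc: "x \<squnion> (y \<squnion> z) = (x \<squnion> y) \<squnion> z"
  and imp_join: "(x \<rightarrow> y \<squnion> z) = (x \<rightarrow> y) \<squnion> (x \<rightarrow> z)"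
  using sqW_star unfolding sqW_star_def qW_star_def by blast+

lemma pl_eq_imp: "pl x = ((x \<rightarrow> \<one>) \<rightarrow> \<one>)"
  and mi_eq_imp: "mi x = ((x \<rightarrow> \<ominus>\<one>) \<rightarrow> \<ominus>\<one>)"
  using sqW_star unfolding sqW_star_def qW_star_def by metis+

lemma imp_self [simp]: "(x \<rightarrow> x) = \<zero>"
proof -
  have "(x \<rightarrow> x) = ((\<one> \<rightarrow> \<one>) \<rightarrow> (x \<rightarrow> x))"
    by (simp add: self_imp_imp)
  also have "\<dots> = (\<ominus>(x \<rightarrow> x) \<rightarrow> \<ominus>(\<one> \<rightarrow> \<one>))"
    by (rule imp_contrapos)
  also have "\<dots> = (\<one> \<rightarrow> \<one>)"
    by (simp add: neg_imp self_imp_imp)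
  finally show ?thesis
    by (simp add: zero_def)
qed

lemma imp_eq_add: "(x \<rightarrow> y) = \<ominus>x \<oplus> y"
  by (simp add: add_def)

lemma add_commute: "x \<oplus> y = y \<oplus> x"
  using imp_contrapos[of "\<ominus>x" y] by (simp add: add_def)

lemma neg_add: "\<ominus>(x \<oplus> y) = \<ominus>x \<oplus> \<ominus>y"
  using imp_contrapos[of y "\<ominus>x"] by (simp add: add_def neg_imp)

lemma add_neg [simp]: "x \<oplus> \<ominus>x = \<zero>"
  using imp_self[of "\<ominus>x"] unfolding add_def by simp

lemma neg_zero [simp]: "\<ominus>\<zero> = \<zero>"
  using neg_imp[of \<one> \<one>] by simp

lemma zero_imp [simp]: "(\<zero> \<rightarrow> x) = \<zero> \<oplus> x"
  by (simp add: imp_eq_add)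

lemma zero_add_imp [simp]: "\<zero> \<oplus> (x \<rightarrow> y) = (x \<rightarrow> y)"
  using self_imp_imp[of \<one> x y] by simp

lemma zero_add_add_right [simp]: "\<zero> \<oplus> (x \<oplus> y) = x \<oplus> y"
  using zero_add_imp[of "\<ominus>x" y] by (simp add: imp_eq_add)

lemma add_add_zero [simp]: "(x \<oplus> y) \<oplus> \<zero> = x \<oplus> y"
  by (simp add: add_commute[of _ \<zero>])

lemma zero_add_zero [simp]: "\<zero> \<oplus> \<zero> = \<zero>"
  using add_neg[of \<zero>] by simp

lemma zero_add_join [simp]: "\<zero> \<oplus> (x \<squnion> y) = x \<squnion> y"
  by (simp add: ajoin_def imp_eq_add)

lemma add_join: "x \<oplus> (y \<squnion> z) = (x \<oplus> y) \<squnion> (x \<oplus> z)"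
  by (simp add: add_def imp_join)

lemma one_add_one_add: "\<one> \<oplus> (\<one> \<oplus> x) = \<one>"
  using one_imp_imp_one[of "\<ominus>x"] by (simp add: imp_eq_add neg_add add_commute[of _ \<one>])

lemma zero_add_one [simp]: "\<zero> \<oplus> \<one> = \<one>"
  by (metis one_add_one_add zero_add_add_right)


subsection \<open>Positive and negative parts\<close>

lemma pl_eq: "pl x = \<one> \<oplus> (\<ominus>\<one> \<oplus> x)"
  by (simp add: pl_eq_imp imp_eq_add neg_add add_commute)

lemma mi_eq: "mi x = \<ominus>\<one> \<oplus> (\<one> \<oplus> x)"
  by (simp add: mi_eq_imp imp_eq_add neg_add add_commute)

lemma neg_pl: "\<ominus>pl x = mi (\<ominus>x)"
  by (simp add: pl_eq mi_eq neg_add)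

lemma neg_mi: "\<ominus>mi x = pl (\<ominus>x)"
  by (simp add: pl_eq mi_eq neg_add)

lemma pl_zero_add [simp]: "pl (\<zero> \<oplus> x) = pl x"
  and mi_zero_add [simp]: "mi (\<zero> \<oplus> x) = mi x"
  using pl_one_imp_one_imp[of x] mi_one_imp_one_imp[of x]
  by (simp_all add: pl_eq_imp mi_eq_imp)

lemma zero_add_pl [simp]: "\<zero> \<oplus> pl x = pl x"
  by (simp add: pl_eq)

lemma pl_add_zero [simp]: "pl x \<oplus> \<zero> = pl x"
  by (simp add: pl_eq)

lemma zero_add_mi [simp]: "\<zero> \<oplus> mi x = mi x"
  by (simp add: mi_eq)

lemma add_decomp: "x \<oplus> y = (pl x \<oplus> pl y) \<oplus> (mi x \<oplus> mi y)"
proof -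
  have "x \<oplus> y = \<ominus>(\<ominus>pl y \<oplus> mi (\<ominus>x)) \<oplus> (\<ominus>pl (\<ominus>x) \<oplus> mi y)"
    using imp_decomp[of "\<ominus>x" y] by (simp add: imp_eq_add)
  also have "\<dots> = (pl y \<oplus> pl x) \<oplus> (mi x \<oplus> mi y)"
    by (simp add: neg_add neg_pl neg_mi)
  finally show ?thesis
    by (simp add: add_commute[of "pl y"])
qed

lemma zero_add_add_left: "(\<zero> \<oplus> x) \<oplus> y = x \<oplus> y"
  using add_decomp[of "\<zero> \<oplus> x" y] add_decomp[of x y] by simp

lemma pl_neg_add_add: "pl (\<ominus>x \<oplus> (x \<oplus> y)) = \<ominus>pl x \<oplus> (pl x \<oplus> pl y)"
  using pl_imp[of x y] by (simp add: imp_eq_add)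

lemma pl_zero [simp]: "pl \<zero> = \<zero>"
  using one_imp_imp_one[of \<one>] by (simp add: pl_eq_imp)

lemma mi_zero [simp]: "mi \<zero> = \<zero>"
  using neg_pl[of \<zero>] by simp

lemma pl_add_mi: "pl x \<oplus> mi x = \<zero> \<oplus> x"
  using add_decomp[of \<zero> x] by simp

lemma pl_one [simp]: "pl \<one> = \<one>"
  by (simp add: pl_eq add_commute[of "\<ominus>\<one>"] add_commute[of _ \<zero>])

lemma mi_one [simp]: "mi \<one> = \<zero>"
proof -
  have "\<one> \<oplus> \<one> = \<one>"
    using one_add_one_add[of \<zero>] by (simp add: add_commute[of _ \<zero>])
  then show ?thesis
    by (simp add: mi_eq add_commute[of "\<ominus>\<one>"])
qed

lemma pl_one_add [simp]: "pl (\<one> \<oplus> x) = \<one> \<oplus> x"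
proof -
  have "\<one> \<oplus> x = (\<one> \<oplus> pl x) \<oplus> mi x"
    using add_decomp[of \<one> x] by simp
  also have "\<one> \<oplus> pl x = \<one>"
    by (simp add: pl_eq one_add_one_add)
  also have "\<one> \<oplus> mi x = pl (\<one> \<oplus> x)"
    by (simp add: pl_eq mi_eq)
  finally show ?thesis ..
qed

lemma pl_pl [simp]: "pl (pl x) = pl x"
  using pl_one_add[of "\<ominus>\<one> \<oplus> x"] by (simp flip: pl_eq)

lemma mi_pl [simp]: "mi (pl x) = \<zero>"
  by (simp add: mi_eq pl_eq one_add_one_add add_commute[of "\<ominus>\<one>"])

lemma join_eq: "x \<squnion> y = (pl x \<oplus> pl (\<ominus>pl x \<oplus> pl y)) \<oplus> (mi x \<oplus> pl (\<ominus>mi x \<oplus> mi y))"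
proof -
  have "x \<squnion> y = \<ominus>(\<ominus>pl (\<ominus>pl x \<oplus> pl y) \<oplus> mi (\<ominus>x)) \<oplus> (\<ominus>mi (\<ominus>mi y \<oplus> mi x) \<oplus> mi x)"
    by (simp add: ajoin_def imp_eq_add)
  also have "\<dots> = (pl (\<ominus>pl x \<oplus> pl y) \<oplus> pl x) \<oplus> (pl (mi y \<oplus> \<ominus>mi x) \<oplus> mi x)"
    by (simp add: neg_add neg_pl neg_mi)
  finally show ?thesis
    by (simp add: add_commute)
qed

lemma join_zero_add_left [simp]: "(\<zero> \<oplus> x) \<squnion> y = x \<squnion> y"
  by (simp add: join_eq)

lemma join_zero_add_right [simp]: "x \<squnion> (\<zero> \<oplus> y) = x \<squnion> y"
  by (simp add: join_eq)

lemma zero_join: "\<zero> \<squnion> x = pl x"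
proof -
  have "pl (mi x) = \<zero>"
    using neg_mi[of "pl (\<ominus>x)"] by (simp add: neg_pl)
  then show ?thesis
    by (simp add: join_eq)
qed


subsection \<open>Nonnegative elements\<close>

lemma nonneg_iff: "nonneg x \<longleftrightarrow> pl x = x"
  unfolding designated_def by (metis pl_eq_imp pl_pl)

lemma nonneg_zero [simp]: "nonneg \<zero>"
  by (simp add: nonneg_iff)

lemma nonneg_pl: "nonneg (pl x)"
  by (simp add: nonneg_iff)

lemma nonneg_one_add: "nonneg (\<one> \<oplus> x)"
  by (simp add: nonneg_iff)

lemma nonneg_one: "nonneg \<one>"
  by (simp add: nonneg_iff)

lemma zero_add_nonneg: "nonneg x \<Longrightarrow> \<zero> \<oplus> x = x"
  by (metis nonneg_iff zero_add_pl)

lemma nonneg_add_zero: "nonneg x \<Longrightarrow> x \<oplus> \<zero> = x"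
  by (simp add: add_commute[of x] zero_add_nonneg)

lemma mi_nonneg: "nonneg x \<Longrightarrow> mi x = \<zero>"
  by (metis nonneg_iff mi_pl)

lemma mi_eq_zero_of_nonneg_zero_add: "nonneg (\<zero> \<oplus> x) \<Longrightarrow> mi x = \<zero>"
  using mi_nonneg[of "\<zero> \<oplus> x"] by simp

lemma pl_neg_nonneg: "nonneg x \<Longrightarrow> pl (\<ominus>x) = \<zero>"
  by (simp add: mi_nonneg flip: neg_mi)

lemma nonpos_exchange:
  assumes "nonneg u" "nonneg v"
  shows "\<ominus>u \<oplus> (\<ominus>v \<oplus> w) = \<ominus>v \<oplus> (\<ominus>u \<oplus> w)"
proof -
  have "(pl u \<rightarrow> pl v \<rightarrow> w) = (pl v \<rightarrow> pl u \<rightarrow> w)"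
    unfolding pl_eq_imp by (rule imp_exchange)
  then show ?thesis
    using assms by (simp add: nonneg_iff imp_eq_add)
qed

lemma nonneg_exchange:
  assumes "nonneg u" "nonneg v"
  shows "u \<oplus> (v \<oplus> w) = v \<oplus> (u \<oplus> w)"
  using arg_cong[OF nonpos_exchange[OF assms, of "\<ominus>w"], of neg] by (simp add: neg_add)

lemma nonneg_add_assoc:
  assumes "nonneg u" "nonneg v" "nonneg w"
  shows "(u \<oplus> v) \<oplus> w = u \<oplus> (v \<oplus> w)"
  using assms nonneg_exchange[of w u v] by (simp add: add_commute)

lemma nonneg_add:
  assumes "nonneg u" "nonneg v"
  shows "nonneg (u \<oplus> v)"
proof -
  have "u \<oplus> v = u \<oplus> (\<one> \<oplus> (\<ominus>\<one> \<oplus> v))"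
    using assms by (simp add: nonneg_iff flip: pl_eq)
  also have "\<dots> = \<one> \<oplus> (u \<oplus> (\<ominus>\<one> \<oplus> v))"
    using assms nonneg_one by (simp add: nonneg_exchange)
  finally show ?thesis
    by (simp add: nonneg_one_add)
qed

lemma join_nonneg:
  assumes "nonneg u" "nonneg v"
  shows "u \<squnion> v = u \<oplus> pl (\<ominus>u \<oplus> v)"
  using assms by (simp add: join_eq mi_nonneg nonneg_iff[THEN iffD1])


subsection \<open>The order\<close>

lemma zero_add_leq_iff [simp]: "\<zero> \<oplus> x \<sqsubseteq> y \<longleftrightarrow> x \<sqsubseteq> y"
  by (simp add: leq_def)

lemma leq_zero_add_iff [simp]: "x \<sqsubseteq> \<zero> \<oplus> y \<longleftrightarrow> x \<sqsubseteq> y"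
  by (simp add: leq_def)

lemma leq_trans [trans]:
  assumes "x \<sqsubseteq> y" "y \<sqsubseteq> z"
  shows "x \<sqsubseteq> z"
proof -
  have "x \<squnion> z = x \<squnion> (y \<squnion> z)"
    using assms(2) by (simp add: leq_def)
  also have "\<dots> = y \<squnion> z"
    using assms(1) by (simp add: join_assoc leq_def)
  finally show ?thesis
    using assms(2) by (simp add: leq_def)
qed

lemma leq_antisym: "x \<sqsubseteq> y \<Longrightarrow> y \<sqsubseteq> x \<Longrightarrow> \<zero> \<oplus> x = \<zero> \<oplus> y"
  by (simp add: leq_def join_commute)

lemma add_left_mono:
  assumes "y \<sqsubseteq> z"
  shows "x \<oplus> y \<sqsubseteq> x \<oplus> z"
proof -
  have "(x \<oplus> y) \<squnion> (x \<oplus> z) = x \<oplus> (\<zero> \<oplus> z)"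
    using assms by (simp add: leq_def flip: add_join)
  then show ?thesis
    by (simp add: leq_def add_commute[of x] zero_add_add_left)
qed

lemma zero_leq_iff: "\<zero> \<sqsubseteq> x \<longleftrightarrow> nonneg (\<zero> \<oplus> x)"
  by (simp add: leq_def zero_join nonneg_iff)

lemma zero_leq_nonneg: "nonneg x \<Longrightarrow> \<zero> \<sqsubseteq> x"
  by (simp add: zero_leq_iff zero_add_nonneg)

lemma neg_add_add_leq:
  assumes "nonneg v" "nonneg w"
  shows "\<ominus>v \<oplus> (v \<oplus> w) \<sqsubseteq> w"
proof -
  let ?s = "v \<oplus> w"
  have nonneg_s: "nonneg ?s"
    using assms by (rule nonneg_add)
  have nonneg_diff: "nonneg (\<ominus>v \<oplus> ?s)"
    using pl_neg_add_add[of v w] assms by (simp add: nonneg_iff)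
  have "\<ominus>\<one> \<oplus> (\<ominus>w \<oplus> (\<ominus>v \<oplus> ?s)) = \<ominus>w \<oplus> (\<ominus>v \<oplus> (\<ominus>\<one> \<oplus> ?s))"
    using assms nonneg_one by (simp add: nonpos_exchange[of \<one>])
  also have "\<dots> = \<ominus>(w \<oplus> (v \<oplus> (\<one> \<oplus> \<ominus>?s)))"
    by (simp add: neg_add)
  also have "\<dots> = \<ominus>(?s \<oplus> (\<one> \<oplus> \<ominus>?s))"
    using assms nonneg_add_assoc[of w v] by (simp add: nonneg_one_add add_commute[of w])
  also have "\<dots> = \<ominus>(\<one> \<oplus> (?s \<oplus> \<ominus>?s))"
    using nonneg_s nonneg_one by (simp add: nonneg_exchange)
  also have "\<dots> = \<ominus>\<one>"
    by (simp add: nonneg_add_zero nonneg_one)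
  finally have "pl (\<ominus>w \<oplus> (\<ominus>v \<oplus> ?s)) = \<zero>"
    by (simp add: pl_eq)
  then have "w \<squnion> (\<ominus>v \<oplus> ?s) = w"
    using assms(2) nonneg_diff by (simp add: join_nonneg nonneg_add_zero)
  then show ?thesis
    using assms(2) by (simp add: leq_def join_commute zero_add_nonneg)
qed

lemma pl_leq_of_diff_eq_zero:
  assumes "\<ominus>x \<oplus> y = \<zero>"
  shows "pl x \<sqsubseteq> pl y"
proof -
  have "pl x = pl (x \<oplus> (\<ominus>x \<oplus> y))"
    using assms by (simp add: add_commute[of x])
  also have "\<dots> = \<ominus>pl (\<ominus>x) \<oplus> (pl (\<ominus>x) \<oplus> pl y)"
    using pl_neg_add_add[of "\<ominus>x" y] by simp
  also have "\<dots> \<sqsubseteq> pl y"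
    by (intro neg_add_add_leq nonneg_pl)
  finally show ?thesis .
qed

lemma pl_eq_of_diff_eq_zero:
  assumes "\<ominus>x \<oplus> y = \<zero>"
  shows "pl x = pl y"
proof -
  have "\<ominus>y \<oplus> x = \<zero>"
    using arg_cong[OF assms, of neg] by (simp add: neg_add add_commute)
  then show ?thesis
    using leq_antisym[of "pl x" "pl y"] assms by (simp add: pl_leq_of_diff_eq_zero)
qed

lemma zero_add_eq_of_diff_eq_zero:
  assumes "\<ominus>x \<oplus> y = \<zero>"
  shows "\<zero> \<oplus> x = \<zero> \<oplus> y"
proof -
  have "\<ominus>(\<ominus>x) \<oplus> \<ominus>y = \<zero>"
    using arg_cong[OF assms, of neg] by (simp add: neg_add)
  then have "\<ominus>mi x = \<ominus>mi y"
    unfolding neg_mi by (rule pl_eq_of_diff_eq_zero)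
  then have "mi x = mi y"
    by (metis neg_neg)
  then show ?thesis
    using pl_eq_of_diff_eq_zero[OF assms] pl_add_mi[of x] pl_add_mi[of y] by simp
qed

theorem nonneg_imp_iff: "nonneg (x \<rightarrow> y) \<longleftrightarrow> x \<sqsubseteq> y"
proof
  assume "x \<sqsubseteq> y"
  then have "\<zero> \<sqsubseteq> \<ominus>x \<oplus> y"
    using add_left_mono[of x y "\<ominus>x"] by (simp add: add_commute[of _ x])
  then show "nonneg (x \<rightarrow> y)"
    by (simp add: imp_eq_add zero_leq_iff)
next
  assume "nonneg (x \<rightarrow> y)"
  have "\<ominus>y \<oplus> (x \<squnion> y) = (\<ominus>y \<oplus> x) \<squnion> (\<ominus>y \<oplus> y)"
    by (rule add_join)
  also have "\<dots> = \<zero> \<squnion> (y \<rightarrow> x)"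
    by (simp add: imp_eq_add join_commute add_commute[of _ y])
  also have "\<dots> = pl (\<ominus>(x \<rightarrow> y))"
    by (simp add: zero_join neg_imp)
  also have "\<dots> = \<zero>"
    using \<open>nonneg (x \<rightarrow> y)\<close> by (rule pl_neg_nonneg)
  finally show "x \<sqsubseteq> y"
    using zero_add_eq_of_diff_eq_zero[of y "x \<squnion> y"] by (simp add: leq_def)
qed

lemma leq_refl [simp]: "x \<sqsubseteq> x"
  by (simp flip: nonneg_imp_iff)

lemma neg_leq_neg: "x \<sqsubseteq> y \<Longrightarrow> \<ominus>y \<sqsubseteq> \<ominus>x"
  using imp_contrapos[of x y] by (simp flip: nonneg_imp_iff)

lemma imp_mono:
  assumes "x \<sqsubseteq> y" "z \<sqsubseteq> w"
  shows "(y \<rightarrow> z) \<sqsubseteq> (x \<rightarrow> w)"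
proof -
  have "\<ominus>y \<oplus> z \<sqsubseteq> \<ominus>y \<oplus> w"
    using assms(2) by (rule add_left_mono)
  also have "\<ominus>y \<oplus> w \<sqsubseteq> \<ominus>x \<oplus> w"
    using add_left_mono[OF neg_leq_neg[OF assms(1)], of w] by (simp add: add_commute[of w])
  finally show ?thesis
    by (simp add: imp_eq_add)
qed

lemma leq_one: "x \<sqsubseteq> \<one>"
  using nonneg_one_add[of "\<ominus>x"] by (simp add: imp_eq_add add_commute flip: nonneg_imp_iff)

lemma zero_add_neg_one [simp]: "\<zero> \<oplus> \<ominus>\<one> = \<ominus>\<one>"
  using neg_add[of \<zero> \<one>] by simp

lemma nonneg_neg_of_nonneg_neg_one:
  assumes "nonneg x" "nonneg (\<ominus>\<one>)"
  shows "nonneg (\<ominus>x)"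
proof -
  have "\<one> \<sqsubseteq> \<zero>"
    using neg_leq_neg[OF zero_leq_nonneg[OF assms(2)]] by simp
  with leq_one have "x \<sqsubseteq> \<zero>"
    by (rule leq_trans)
  then have "nonneg (\<ominus>x \<oplus> \<zero>)"
    by (simp add: imp_eq_add flip: nonneg_imp_iff)
  moreover have "\<ominus>x \<oplus> \<zero> = \<ominus>x"
    using neg_add[of x \<zero>] assms(1) by (simp add: nonneg_add_zero)
  ultimately show ?thesis by simp
qed


subsection \<open>Soundness\<close>

abbreviation val :: "('v \<Rightarrow> 'a) \<Rightarrow> 'v fm \<Rightarrow> 'a" where
  "val \<equiv> eval imp neg \<one>"

lemma val_fplus: "val e (fplus p) = pl (val e p)"
  by (simp add: fplus_def pl_eq_imp)

lemma val_fminus: "val e (fminus p) = mi (val e p)"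
  by (simp add: fminus_def mi_eq_imp)

lemma val_fjoin: "val e (fjoin p q) = val e p \<squnion> val e q"
  by (simp add: fjoin_def ajoin_def val_fplus val_fminus)

lemma axiom_nonneg:
  assumes "axiom p"
  shows "nonneg (val e p)"
  using assms
proof cases
  case Q7a
  then show ?thesis by (simp add: nonneg_imp_iff val_fjoin join_commute flip: imp_join)
next
  case Q7b
  then show ?thesis by (simp add: nonneg_imp_iff val_fjoin join_commute flip: imp_join)
  \<comment> \<open>Except in Q10, the two sides of the other axioms have equal values, up to a summand \<open>\<zero>\<close> in Q3.\<close>
qed (simp_all add: nonneg_imp_iff val_fplus val_fminus val_fjoin
  imp_contrapos[symmetric] one_imp_imp_one imp_decomp[symmetric] neg_imp pl_imp join_assoc imp_exchange
  leq_one)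

lemma deriv_nonneg:
  assumes "deriv H q" "\<forall>p\<in>set H. nonneg (val e p)"
  shows "nonneg (val e q)"
  using assms(1)
proof induction
  case (ax p)
  then show ?case by (rule axiom_nonneg)
next
  case (hyp p)
  then show ?case using assms(2) by blast
next
  case (qMP r p q)
  from qMP.IH(1) have "\<zero> \<sqsubseteq> val e p"
    by (simp add: zero_leq_iff)
  also from qMP.IH(2) have "\<dots> \<sqsubseteq> val e q"
    by (simp add: nonneg_imp_iff)
  finally show ?case
    by (simp add: zero_leq_iff)
next
  case (Reg p r)
  then show ?case by (simp add: zero_add_nonneg)
next
  case (Flat p)
  then show ?case by (simp add: nonneg_neg_of_nonneg_neg_one)
next
  case (R2' p q r t)
  then show ?case by (simp add: nonneg_imp_iff imp_mono)
next
  case (R3' r p)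
  then show ?case by (simp add: val_fminus mi_eq_zero_of_nonneg_zero_add)
qed (simp_all add: neg_imp nonneg_one)

end

theorem theorem4p2:
  fixes H :: "'v fm list" and q :: "'v fm"
  assumes "deriv H q"
  shows "sem_conseq TYPE('a) H q"
  unfolding sem_conseq_def
proof (intro allI impI)
  fix imp :: "'a \<Rightarrow> 'a \<Rightarrow> 'a" and neg pl mi one and e :: "'v \<Rightarrow> 'a"
  assume "sqW_star imp neg pl mi one"
    and hyps: "\<forall>p\<in>set H. designated imp one (eval imp neg one e p)"
  then interpret strong_quasi_wajsberg_star imp neg pl mi one
    by unfold_locales
  show "designated imp one (eval imp neg one e q)"
    using assms hyps by (rule deriv_nonneg)
qed

end
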